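(* Let $X$ be a fibrant diffeological space. Then every $D$-open subset of $X$, with the sub-diffeology, is also fibrant.
   Context: A diffeological space is a set $X$ together with, for each $n\in\mathbb{N}$ and each open $U\subseteq\mathbb{R}^n$, a specified set of functions $U\to X$ called plots, such that: every constant map is a plot; if $U\to X$ is a plot and $V\to U$ is a smooth map between open subsets of Euclidean spaces then the composite $V\to X$ is a plot; and a function $U\to X$ whose restriction to each member of some open cover of $U$ is a plot is itself a plot. A map $f:X\to Y$ is smooth if $f\circ p$ is a plot of $Y$ for every plot $p$ of $X$; $C^\infty(X,Y)$ is the set of smooth maps. $\mathbb{R}^n$ has as plots the usual smooth maps. A subset $A\subseteq X$ has the sub-diffeology: $U\to A$ is a plot iff $U\to A\hookrightarrow X$ is. The $D$-topology on $X$ is the final topology induced by its plots (domains with their usual topology); a $D$-open subset is a subset open in this topology. Let $\mathbb{A}^n=\{(x_0,\dots,x_n)\in\mathbb{R}^{n+1}\mid\sum x_i=1\}$ with the sub-diffeology from $\mathbb{R}^{n+1}$. A map $f:\{0,\dots,n\}\to\{0,\dots,m\}$ in the simplicial category induces $f_*:\mathbb{A}^n\to\mathbb{A}^m$, $f_*(x)_j=\sum_{i\in f^{-1}(j)}x_i$. $S^D(X)$ is the simplicial set with $S^D_n(X)=C^\infty(\mathbb{A}^n,X)$ and structure maps given by precomposition. A diffeological space $X$ is fibrant if $S^D(X)$ is a Kan complex. *)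

theory Defs
  imports "HOL-Analysis.Analysis"
begin

section \<open>Smooth maps between open subsets of Euclidean spaces\<close>

text \<open>
  The space \<open>\<real>\<^sup>n\<close> is \<^const>\<open>Euclidean_space\<close> \<open>n\<close>: its points are the functions \<open>x :: nat \<Rightarrow> real\<close> with
  \<open>x i = 0\<close> for \<open>i \<ge> n\<close>. This lets the dimension vary inside definitions.

  For open \<open>U \<subseteq> \<real>\<^sup>n\<close>, \<open>C_k n k U f\<close> says that all partial derivatives of \<open>f\<close> of order at most
  \<open>k\<close> exist and are continuous on \<open>U\<close>. Since \<open>U\<close> is open, only the values of \<open>f\<close> on \<open>U\<close> matter,
  and the \<open>g\<close> below is uniquely determined on \<open>U\<close>.
\<close>

primrec C_k :: "nat \<Rightarrow> nat \<Rightarrow> (nat \<Rightarrow> real) set \<Rightarrow> ((nat \<Rightarrow> real) \<Rightarrow> real) \<Rightarrow> bool" where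
  "C_k n 0 U f \<longleftrightarrow> continuous_map (subtopology (Euclidean_space n) U) euclideanreal f"
| "C_k n (Suc k) U f \<longleftrightarrow>
     continuous_map (subtopology (Euclidean_space n) U) euclideanreal f \<and>
     (\<forall>i<n. \<exists>g. (\<forall>x\<in>U. ((\<lambda>t. f (x(i := t))) has_real_derivative g x) (at (x i))) \<and> C_k n k U g)"

definition smooth_euclidean ::
    "nat \<Rightarrow> (nat \<Rightarrow> real) set \<Rightarrow> nat \<Rightarrow> ((nat \<Rightarrow> real) \<Rightarrow> (nat \<Rightarrow> real)) \<Rightarrow> bool" where
  "smooth_euclidean n U m f \<longleftrightarrow>
     f \<in> U \<rightarrow> topspace (Euclidean_space m) \<and> (\<forall>j<m. \<forall>k. C_k n k U (\<lambda>x. f x j))"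


section \<open>Diffeological spaces\<close>

text \<open>
  \<open>plots X n U\<close> is the set of plots with domain the open set \<open>U \<subseteq> \<real>\<^sup>n\<close>. Functions with domain \<open>U\<close>
  are represented by extensional functions, so that equality of plots is equality on \<open>U\<close>.
\<close>

record 'a diffeology =
  points :: "'a set"
  plots :: "nat \<Rightarrow> (nat \<Rightarrow> real) set \<Rightarrow> ((nat \<Rightarrow> real) \<Rightarrow> 'a) set"

definition diffeological_space :: "'a diffeology \<Rightarrow> bool" where
  "diffeological_space X \<longleftrightarrow>
     (\<forall>n U p. p \<in> plots X n U \<longrightarrow> openin (Euclidean_space n) U \<and> p \<in> U \<rightarrow>\<^sub>E points X) \<and>
     (\<forall>n U. \<forall>c\<in>points X. openin (Euclidean_space n) U \<longrightarrow> (\<lambda>u\<in>U. c) \<in> plots X n U) \<and>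
     (\<forall>n U m V p h.
        p \<in> plots X n U \<and> openin (Euclidean_space m) V \<and> smooth_euclidean m V n h \<and> h \<in> V \<rightarrow> U
        \<longrightarrow> compose V p h \<in> plots X m V) \<and>
     (\<forall>n U p \<C>.
        openin (Euclidean_space n) U \<and> p \<in> U \<rightarrow>\<^sub>E points X \<and>
        (\<forall>V\<in>\<C>. openin (Euclidean_space n) V \<and> restrict p V \<in> plots X n V) \<and> \<Union>\<C> = U
        \<longrightarrow> p \<in> plots X n U)"

definition smooth_maps :: "'a diffeology \<Rightarrow> 'b diffeology \<Rightarrow> ('a \<Rightarrow> 'b) set" where
  "smooth_maps X Y =
     {f \<in> points X \<rightarrow>\<^sub>E points Y. \<forall>n U. \<forall>p\<in>plots X n U. compose U f p \<in> plots Y n U}"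

definition euclidean_diffeology :: "nat \<Rightarrow> (nat \<Rightarrow> real) diffeology" where
  "euclidean_diffeology m =
     \<lparr>points = topspace (Euclidean_space m),
      plots = (\<lambda>n U. {p \<in> U \<rightarrow>\<^sub>E topspace (Euclidean_space m).
                        openin (Euclidean_space n) U \<and> smooth_euclidean n U m p})\<rparr>"

definition sub_diffeology :: "'a diffeology \<Rightarrow> 'a set \<Rightarrow> 'a diffeology" where
  "sub_diffeology X A = \<lparr>points = A, plots = (\<lambda>n U. {p \<in> plots X n U. p \<in> U \<rightarrow> A})\<rparr>"

definition D_topology :: "'a diffeology \<Rightarrow> 'a topology" where
  "D_topology X = topology (\<lambda>A. A \<subseteq> points X \<and>
     (\<forall>n U. \<forall>p\<in>plots X n U. openin (subtopology (Euclidean_space n) U) {u \<in> U. p u \<in> A}))"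

lemma openin_D_topology:
  assumes "diffeological_space X"
  shows "openin (D_topology X) A \<longleftrightarrow> A \<subseteq> points X \<and>
     (\<forall>n U. \<forall>p\<in>plots X n U. openin (subtopology (Euclidean_space n) U) {u \<in> U. p u \<in> A})"
proof -
  have "istopology (\<lambda>A. A \<subseteq> points X \<and>
     (\<forall>n U. \<forall>p\<in>plots X n U. openin (subtopology (Euclidean_space n) U) {u \<in> U. p u \<in> A}))"
    (is "istopology ?P")
    unfolding istopology_def
  proof (rule conjI; intro allI impI)
    fix S T assume "?P S" "?P T"
    moreover have "{u \<in> U. p u \<in> S \<inter> T} = {u \<in> U. p u \<in> S} \<inter> {u \<in> U. p u \<in> T}"
      for U and p :: "(nat \<Rightarrow> real) \<Rightarrow> 'a"
      by auto
    ultimately show "?P (S \<inter> T)"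
      by (simp only: openin_Int le_infI1 simp_thms) blast
  next
    fix \<K> assume K: "\<forall>K\<in>\<K>. ?P K"
    moreover have "{u \<in> U. p u \<in> \<Union>\<K>} = (\<Union>K\<in>\<K>. {u \<in> U. p u \<in> K})"
      for U and p :: "(nat \<Rightarrow> real) \<Rightarrow> 'a"
      by auto
    ultimately show "?P (\<Union>\<K>)"
      by (auto intro!: openin_clauses(3))
  qed
  then show ?thesis
    by (simp add: D_topology_def topology_inverse')
qed

lemma topspace_D_topology:
  assumes "diffeological_space X"
  shows "topspace (D_topology X) = points X"
proof (rule antisym)
  show "topspace (D_topology X) \<subseteq> points X"
    using openin_D_topology[OF assms, of "topspace (D_topology X)"] by simp
  have "openin (subtopology (Euclidean_space n) U) {u \<in> U. p u \<in> points X}"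
    if "p \<in> plots X n U" for n U p
  proof -
    have "openin (Euclidean_space n) U" "p \<in> U \<rightarrow>\<^sub>E points X"
      using assms[unfolded diffeological_space_def, THEN conjunct1, rule_format, OF that] by auto
    then have "{u \<in> U. p u \<in> points X} = U" "topspace (subtopology (Euclidean_space n) U) = U"
      by (auto dest: openin_subset)
    then show ?thesis
      by (metis openin_topspace)
  qed
  then have "openin (D_topology X) (points X)"
    by (simp add: openin_D_topology[OF assms])
  then show "points X \<subseteq> topspace (D_topology X)"
    by (rule openin_subset)
qed

lemma diffeological_space_sub_diffeology:
  assumes X: "diffeological_space X" and A: "A \<subseteq> points X"
  shows "diffeological_space (sub_diffeology X A)"
proof -
  have 1: "openin (Euclidean_space n) U" "p \<in> U \<rightarrow>\<^sub>E points X" if "p \<in> plots X n U" for n U p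
    using X[unfolded diffeological_space_def, THEN conjunct1, rule_format, OF that] by auto
  have 2: "(\<lambda>u\<in>U. c) \<in> plots X n U" if "c \<in> points X" "openin (Euclidean_space n) U" for n U c
    using X[unfolded diffeological_space_def, THEN conjunct2, THEN conjunct1] that by simp
  have 3: "compose V p h \<in> plots X m V"
    if "p \<in> plots X n U" "openin (Euclidean_space m) V" "smooth_euclidean m V n h" "h \<in> V \<rightarrow> U"
    for n U m V p h
    using X[unfolded diffeological_space_def, THEN conjunct2, THEN conjunct2, THEN conjunct1] that
    by simp
  have 4: "p \<in> plots X n U"
    if "openin (Euclidean_space n) U" "p \<in> U \<rightarrow>\<^sub>E points X" "\<Union>\<C> = U"
      "\<forall>V\<in>\<C>. openin (Euclidean_space n) V \<and> restrict p V \<in> plots X n V" for n U p \<C>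
    using X[unfolded diffeological_space_def, THEN conjunct2, THEN conjunct2, THEN conjunct2,
        rule_format, of n U p \<C>] that
    by simp
  show ?thesis
    unfolding diffeological_space_def
  proof (intro conjI allI impI ballI)
    fix n U p assume "p \<in> plots (sub_diffeology X A) n U"
    then show "openin (Euclidean_space n) U" "p \<in> U \<rightarrow>\<^sub>E points (sub_diffeology X A)"
      using 1[of p n U] by (auto simp: sub_diffeology_def PiE_iff)
  next
    fix n U c assume "c \<in> points (sub_diffeology X A)" "openin (Euclidean_space n) U"
    then show "(\<lambda>u\<in>U. c) \<in> plots (sub_diffeology X A) n U"
      using 2[of c n U] A by (auto simp: sub_diffeology_def)
  next
    fix n U m V p h
    assume "p \<in> plots (sub_diffeology X A) n U \<and> openin (Euclidean_space m) V \<and>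
            smooth_euclidean m V n h \<and> h \<in> V \<rightarrow> U"
    then show "compose V p h \<in> plots (sub_diffeology X A) m V"
      using 3[of p n U m V h] by (simp add: sub_diffeology_def compose_def Pi_iff)
  next
    fix n U p \<C>
    assume "openin (Euclidean_space n) U \<and> p \<in> U \<rightarrow>\<^sub>E points (sub_diffeology X A) \<and>
        (\<forall>V\<in>\<C>. openin (Euclidean_space n) V \<and> restrict p V \<in> plots (sub_diffeology X A) n V) \<and>
        \<Union>\<C> = U"
    then show "p \<in> plots (sub_diffeology X A) n U"
      using 4[of n U p \<C>] A by (simp add: sub_diffeology_def PiE_iff Pi_iff subset_iff)
  qed
qed


section \<open>Simplicial sets and Kan complexes\<close>

text \<open>The morphisms \<open>[n] \<rightarrow> [m]\<close> of the simplicial category, where \<open>[n] = {0, \<dots>, n}\<close>.\<close>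

definition simplex_maps :: "nat \<Rightarrow> nat \<Rightarrow> (nat \<Rightarrow> nat) set" where
  "simplex_maps n m = {f \<in> {..n} \<rightarrow>\<^sub>E {..m}. mono_on {..n} f}"

text \<open>For \<open>f : [n] \<rightarrow> [m]\<close>, \<open>action K n m f\<close> is the induced map from the \<open>m\<close>-simplices to the
  \<open>n\<close>-simplices of \<open>K\<close>.\<close>

record 'b simplicial =
  simplices :: "nat \<Rightarrow> 'b set"
  action :: "nat \<Rightarrow> nat \<Rightarrow> (nat \<Rightarrow> nat) \<Rightarrow> 'b \<Rightarrow> 'b"

definition simplicial_set :: "'b simplicial \<Rightarrow> bool" where
  "simplicial_set K \<longleftrightarrow>
     (\<forall>n m. \<forall>f\<in>simplex_maps n m. action K n m f \<in> simplices K m \<rightarrow> simplices K n) \<and>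
     (\<forall>n. \<forall>s\<in>simplices K n. action K n n (\<lambda>i\<in>{..n}. i) s = s) \<and>
     (\<forall>n m l. \<forall>f\<in>simplex_maps n m. \<forall>g\<in>simplex_maps m l. \<forall>s\<in>simplices K l.
        action K n l (compose {..n} g f) s = action K n m f (action K m l g s))"

definition simplicial_morphism ::
    "'b simplicial \<Rightarrow> 'c simplicial \<Rightarrow> (nat \<Rightarrow> 'b \<Rightarrow> 'c) \<Rightarrow> bool" where
  "simplicial_morphism K L \<phi> \<longleftrightarrow>
     (\<forall>n. \<phi> n \<in> simplices K n \<rightarrow> simplices L n) \<and>
     (\<forall>n m. \<forall>f\<in>simplex_maps n m. \<forall>s\<in>simplices K m.
        \<phi> n (action K n m f s) = action L n m f (\<phi> m s))"

definition standard_simplex :: "nat \<Rightarrow> (nat \<Rightarrow> nat) simplicial" where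
  "standard_simplex N =
     \<lparr>simplices = (\<lambda>n. simplex_maps n N),
      action = (\<lambda>n m f s. compose {..n} s f)\<rparr>"

text \<open>The horn \<open>\<Lambda>\<^sup>N\<^sub>k\<close> is the union of the faces of the standard simplex other than the one
  opposite to the vertex \<open>k\<close>: its simplices miss some vertex different from \<open>k\<close>.\<close>

definition horn :: "nat \<Rightarrow> nat \<Rightarrow> (nat \<Rightarrow> nat) simplicial" where
  "horn N k =
     \<lparr>simplices = (\<lambda>n. {s \<in> simplex_maps n N. \<exists>i\<le>N. i \<noteq> k \<and> i \<notin> s ` {..n}}),
      action = action (standard_simplex N)\<rparr>"

definition Kan_complex :: "'b simplicial \<Rightarrow> bool" where
  "Kan_complex K \<longleftrightarrow>
     simplicial_set K \<and>
     (\<forall>N k \<phi>. 1 \<le> N \<and> k \<le> N \<and> simplicial_morphism (horn N k) K \<phi> \<longrightarrow>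
        (\<exists>\<psi>. simplicial_morphism (standard_simplex N) K \<psi> \<and>
             (\<forall>n. \<forall>s\<in>simplices (horn N k) n. \<psi> n s = \<phi> n s)))"

lemma simplex_maps_compose:
  assumes "f \<in> simplex_maps n m" "g \<in> simplex_maps m l"
  shows "compose {..n} g f \<in> simplex_maps n l"
  using assms by (fastforce simp: simplex_maps_def compose_def PiE_iff mono_on_def)

lemma simplex_maps_identity:
  assumes "s \<in> simplex_maps n m"
  shows "compose {..n} s (\<lambda>i\<in>{..n}. i) = s"
  using assms by (auto simp: simplex_maps_def compose_def PiE_iff extensional_def)

lemma simplicial_set_standard_simplex: "simplicial_set (standard_simplex N)"
proof -
  have "compose {..n} s (compose {..n} g f) = compose {..n} (compose {..m} s g) f"
    if "f \<in> simplex_maps n m" for n m f and g s :: "nat \<Rightarrow> nat"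
    using that by (intro compose_assoc) (simp add: simplex_maps_def PiE_iff Pi_iff)
  then show ?thesis
    unfolding simplicial_set_def standard_simplex_def
    by (simp add: simplex_maps_compose simplex_maps_identity)
qed

lemma simplicial_set_horn: "simplicial_set (horn N k)"
proof -
  have "compose {..n} s f ` {..n} \<subseteq> s ` {..m}" if "f \<in> simplex_maps n m" for n m f and s :: "nat \<Rightarrow> nat"
    using that by (auto simp: simplex_maps_def compose_def PiE_iff Pi_iff)
  then show ?thesis
    using simplicial_set_standard_simplex[of N]
    unfolding simplicial_set_def horn_def
    by (simp add: Pi_iff standard_simplex_def) (meson subsetD)
qed


section \<open>The smooth singular simplicial set and fibrancy\<close>

definition affine_simplex :: "nat \<Rightarrow> (nat \<Rightarrow> real) diffeology" where
  "affine_simplex n =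
     sub_diffeology (euclidean_diffeology (Suc n))
       {x \<in> topspace (Euclidean_space (Suc n)). (\<Sum>i\<le>n. x i) = 1}"

text \<open>The map \<open>f\<^sub>*\<close> induced by \<open>f : [n] \<rightarrow> [m]\<close>; coordinates \<open>j > m\<close> are empty sums, hence 0.\<close>

definition affine_push :: "nat \<Rightarrow> (nat \<Rightarrow> nat) \<Rightarrow> (nat \<Rightarrow> real) \<Rightarrow> (nat \<Rightarrow> real)" where
  "affine_push n f x = (\<lambda>j. \<Sum>i | i \<le> n \<and> f i = j. x i)"

definition smooth_singular :: "'a diffeology \<Rightarrow> ((nat \<Rightarrow> real) \<Rightarrow> 'a) simplicial" where
  "smooth_singular X =
     \<lparr>simplices = (\<lambda>n. smooth_maps (affine_simplex n) X),
      action = (\<lambda>n m f \<sigma>. compose (points (affine_simplex n)) \<sigma> (affine_push n f))\<rparr>"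

definition fibrant :: "'a diffeology \<Rightarrow> bool" where
  "fibrant X \<longleftrightarrow> diffeological_space X \<and> Kan_complex (smooth_singular X)"

end

theory Submission
  imports Defs
begin

text \<open>
  Let a horn \<open>\<phi>\<close> of dimension \<open>N\<close> in \<open>S\<^sup>D(A)\<close> be given, without the face opposite to the vertex \<open>k\<close>.
  Regarded as a horn in \<open>S\<^sup>D(X)\<close> it has a filler, that is, a smooth map \<open>\<sigma> : \<bbbA>\<^sup>N \<rightarrow> X\<close>. The set
  \<open>W = {x \<in> \<bbbA>\<^sup>N. \<sigma> x \<in> A}\<close> is open because \<open>A\<close> is \<open>D\<close>-open (\<open>preimage_D_open\<close>), and it contains the
  union \<open>H\<close> of the hyperplanes \<open>x\<^sub>i = 0\<close> with \<open>i \<noteq> k\<close>, because \<open>\<sigma>\<close> is given by \<open>\<phi>\<close> on \<open>H\<close>. If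
  \<open>\<rho> : \<bbbA>\<^sup>N \<rightarrow> \<bbbA>\<^sup>N\<close> is a smooth map with values in \<open>W\<close> that fixes \<open>H\<close> pointwise, then \<open>\<sigma> \<circ> \<rho>\<close> takes its
  values in \<open>A\<close> and agrees with \<open>\<sigma>\<close> on \<open>H\<close>, so it fills the horn \<open>\<phi>\<close> in \<open>S\<^sup>D(A)\<close>.

  The point is the construction of \<open>\<rho>\<close> (\<open>smooth_deformation_into_horn_neighbourhood\<close>), where the
  difficulty is that \<open>W\<close> may become arbitrarily thin at infinity. Let \<open>P x\<close> be the product and \<open>Q x\<close> the
  sum of the squares of the coordinates \<open>x\<^sub>i\<close> with \<open>i \<noteq> k\<close>; thus \<open>H = {P = 0}\<close>. By compactness there are
  \<open>\<epsilon>\<^sub>n > 0\<close> such that \<open>x \<in> W\<close> whenever \<open>Q x \<le> n\<close> and \<open>\<bar>P x\<bar> \<le> \<epsilon>\<^sub>n\<close> (\<open>horn_neighbourhood\<close>). The map \<open>\<rho>\<close>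
  moves \<open>x\<close> towards the vertex \<open>e\<^sub>k\<close>, \<open>\<rho> x = e\<^sub>k + t x (x - e\<^sub>k)\<close>, with the factor
  \<open>t x = exp (- (P x)\<^sup>2 G (1 + Q x))\<close>, where \<open>G\<close> is an entire power series with \<open>G y \<ge> 1 / \<epsilon>\<^sub>n\<^sup>2\<close> for
  \<open>y \<ge> n \<ge> 1\<close> (\<open>power_series_dominating\<close>). Then \<open>t = 1\<close> on \<open>H\<close>, the map does not increase \<open>Q\<close>, and
  \<open>\<bar>P (\<rho> x)\<bar> \<le> t x \<bar>P x\<bar> \<le> \<bar>P x\<bar> / (1 + (P x)\<^sup>2 / \<epsilon>\<^sub>n\<^sup>2) \<le> \<epsilon>\<^sub>n\<close> for \<open>n = \<lfloor>1 + Q x\<rfloor>\<close>, so that \<open>\<rho> x \<in> W\<close>.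
  Since \<open>\<rho>\<close> is built from the coordinates by sums, products and entire functions of one real
  variable, its smoothness needs no chain rule in several variables.
\<close>

section \<open>Closure properties of differentiable functions\<close>

lemma C_k_continuous: "C_k n k U f \<Longrightarrow> continuous_map (subtopology (Euclidean_space n) U) euclideanreal f"
  by (cases k) auto

lemma C_k_Suc_imp: "C_k n (Suc k) U f \<Longrightarrow> C_k n k U f"
proof (induction k arbitrary: f)
  case 0
  then show ?case by simp
next
  case (Suc k)
  show ?case
    unfolding C_k.simps(2)[of n k]
  proof (intro conjI allI impI)
    show "continuous_map (subtopology (Euclidean_space n) U) euclideanreal f"
      using Suc.prems by simp
    fix i assume "i < n"
    then obtain g where "\<forall>x\<in>U. ((\<lambda>t. f (x(i := t))) has_real_derivative g x) (at (x i))"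
        "C_k n (Suc k) U g"
      using Suc.prems unfolding C_k.simps(2)[of n "Suc k"] by blast
    then show "\<exists>g. (\<forall>x\<in>U. ((\<lambda>t. f (x(i := t))) has_real_derivative g x) (at (x i))) \<and> C_k n k U g"
      using Suc.IH by blast
  qed
qed

lemma C_k_const: "C_k n k U (\<lambda>x. c)"
  by (induction k arbitrary: c) (auto intro!: exI[of _ "\<lambda>x. 0"])

lemma C_k_coordinate: "C_k n k U (\<lambda>x. x j)"
proof -
  have cont: "continuous_map (subtopology (Euclidean_space n) U) euclideanreal (\<lambda>x. x j)"
    unfolding Euclidean_space_def
    by (intro continuous_map_from_subtopology continuous_map_product_projection) auto
  have "\<exists>g. (\<forall>x\<in>U. ((\<lambda>t. (x(i := t)) j) has_real_derivative g x) (at (x i))) \<and> C_k n k U g"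
    for i k
    by (cases "i = j")
      (auto intro!: exI[of _ "\<lambda>x. if i = j then 1 else 0"] derivative_eq_intros simp: C_k_const)
  then show ?thesis
    using cont by (cases k) (auto simp del: fun_upd_apply)
qed

lemma C_k_add: "C_k n k U f \<Longrightarrow> C_k n k U g \<Longrightarrow> C_k n k U (\<lambda>x. f x + g x)"
proof (induction k arbitrary: f g)
  case 0
  then show ?case by (auto intro: continuous_map_add)
next
  case (Suc k)
  show ?case
    unfolding C_k.simps(2)
  proof (intro conjI allI impI)
    show "continuous_map (subtopology (Euclidean_space n) U) euclideanreal (\<lambda>x. f x + g x)"
      using Suc.prems by (auto intro: continuous_map_add)
    fix i assume "i < n"
    then obtain f' g' where
        f': "\<forall>x\<in>U. ((\<lambda>t. f (x(i := t))) has_real_derivative f' x) (at (x i))" "C_k n k U f'"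
      and g': "\<forall>x\<in>U. ((\<lambda>t. g (x(i := t))) has_real_derivative g' x) (at (x i))" "C_k n k U g'"
      using Suc.prems unfolding C_k.simps(2) by blast
    show "\<exists>h. (\<forall>x\<in>U. ((\<lambda>t. f (x(i := t)) + g (x(i := t))) has_real_derivative h x) (at (x i)))
            \<and> C_k n k U h"
      using f' g' Suc.IH by (intro exI[of _ "\<lambda>x. f' x + g' x"]) (auto intro: DERIV_add)
  qed
qed

lemma C_k_mult: "C_k n k U f \<Longrightarrow> C_k n k U g \<Longrightarrow> C_k n k U (\<lambda>x. f x * g x)"
proof (induction k arbitrary: f g)
  case 0
  then show ?case by (auto intro: continuous_map_real_mult)
next
  case (Suc k)
  show ?case
    unfolding C_k.simps(2)
  proof (intro conjI allI impI)
    show "continuous_map (subtopology (Euclidean_space n) U) euclideanreal (\<lambda>x. f x * g x)"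
      using Suc.prems by (auto intro: continuous_map_real_mult)
    fix i assume "i < n"
    then obtain f' g' where
        f': "\<forall>x\<in>U. ((\<lambda>t. f (x(i := t))) has_real_derivative f' x) (at (x i))" "C_k n k U f'"
      and g': "\<forall>x\<in>U. ((\<lambda>t. g (x(i := t))) has_real_derivative g' x) (at (x i))" "C_k n k U g'"
      using Suc.prems unfolding C_k.simps(2) by blast
    have "C_k n k U (\<lambda>x. f' x * g x + g' x * f x)"
      by (intro C_k_add Suc.IH f'(2) g'(2) C_k_Suc_imp[OF Suc.prems(1)] C_k_Suc_imp[OF Suc.prems(2)])
    moreover have "((\<lambda>t. f (x(i := t)) * g (x(i := t))) has_real_derivative f' x * g x + g' x * f x)
        (at (x i))" if "x \<in> U" for x
      using DERIV_mult[OF f'(1)[rule_format, OF that] g'(1)[rule_format, OF that]] by simp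
    ultimately show
      "\<exists>h. (\<forall>x\<in>U. ((\<lambda>t. f (x(i := t)) * g (x(i := t))) has_real_derivative h x) (at (x i)))
            \<and> C_k n k U h"
      by (intro exI[of _ "\<lambda>x. f' x * g x + g' x * f x"] conjI ballI)
  qed
qed

lemma C_k_sum: "finite I \<Longrightarrow> (\<And>i. i \<in> I \<Longrightarrow> C_k n k U (f i)) \<Longrightarrow> C_k n k U (\<lambda>x. \<Sum>i\<in>I. f i x)"
  by (induction I rule: finite_induct) (auto intro: C_k_const C_k_add)

lemma C_k_prod: "finite I \<Longrightarrow> (\<And>i. i \<in> I \<Longrightarrow> C_k n k U (f i)) \<Longrightarrow> C_k n k U (\<lambda>x. \<Prod>i\<in>I. f i x)"
  by (induction I rule: finite_induct) (auto intro: C_k_const C_k_mult)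

text \<open>
  Composition with a smooth function of one real variable: \<open>D j\<close> is its \<open>j\<close>-th derivative.
\<close>

lemma C_k_compose:
  assumes D: "\<And>j y. (D j has_real_derivative D (Suc j) y) (at y)"
  shows "C_k n k U f \<Longrightarrow> C_k n k U (\<lambda>x. D j (f x))"
proof (induction k arbitrary: f j)
  case (0 f j)
  have "continuous_map euclideanreal euclideanreal (D j)"
    using D by (auto intro!: DERIV_isCont continuous_at_imp_continuous_on)
  then show ?case
    using continuous_map_compose[of _ _ f _ "D j"] 0 by (simp add: o_def)
next
  case (Suc k f j)
  show ?case
    unfolding C_k.simps(2)
  proof (intro conjI allI impI)
    have D_cont: "continuous_map euclideanreal euclideanreal (D j)"
      using D by (auto intro!: DERIV_isCont continuous_at_imp_continuous_on)
    show "continuous_map (subtopology (Euclidean_space n) U) euclideanreal (\<lambda>x. D j (f x))"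
      using continuous_map_compose[OF C_k_continuous[OF Suc.prems] D_cont] unfolding o_def .
    fix i assume "i < n"
    then obtain f' where
        f': "\<forall>x\<in>U. ((\<lambda>t. f (x(i := t))) has_real_derivative f' x) (at (x i))" "C_k n k U f'"
      using Suc.prems unfolding C_k.simps(2) by blast
    have "C_k n k U (\<lambda>x. D (Suc j) (f x) * f' x)"
      by (intro C_k_mult Suc.IH C_k_Suc_imp[OF Suc.prems] f'(2))
    moreover have "((\<lambda>t. D j (f (x(i := t)))) has_real_derivative D (Suc j) (f x) * f' x) (at (x i))"
      if "x \<in> U" for x
      using DERIV_chain2[of "D j" _ "\<lambda>t. f (x(i := t))" "x i", OF _ f'(1)[rule_format, OF that]] D
      by simp
    ultimately show
      "\<exists>h. (\<forall>x\<in>U. ((\<lambda>t. D j (f (x(i := t)))) has_real_derivative h x) (at (x i))) \<and> C_k n k U h"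
      by (intro exI[of _ "\<lambda>x. D (Suc j) (f x) * f' x"] conjI ballI)
  qed
qed

lemma C_k_if:
  "(b \<Longrightarrow> C_k n k U f) \<Longrightarrow> (\<not> b \<Longrightarrow> C_k n k U g) \<Longrightarrow> C_k n k U (\<lambda>x. if b then f x else g x)"
  by (cases b) auto

lemma openin_Euclidean_spaceE:
  assumes "openin (Euclidean_space n) U"
  obtains T where "open T" "U = T \<inter> {x. \<forall>i\<ge>n. x i = 0}"
proof -
  have "openin (top_of_set {x. \<forall>i\<ge>n. x i = 0}) U"
    using assms unfolding Euclidean_space_def by (simp only: euclidean_product_topology)
  then obtain T where T: "open T" "U = {x. \<forall>i\<ge>n. x i = 0} \<inter> T"
    unfolding openin_open by (elim exE conjE)
  show ?thesis by (rule that[OF T(1)]) (simp only: T(2) Int_commute)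
qed

text \<open>
  The derivatives in \<^const>\<open>C_k\<close> involve values of the function outside \<open>U\<close>, so it is the openness
  of \<open>U\<close> which makes them depend on the values on \<open>U\<close> only.
\<close>

lemma C_k_cong:
  assumes U: "openin (Euclidean_space n) U" and fg: "\<And>x. x \<in> U \<Longrightarrow> f x = g x" and f: "C_k n k U f"
  shows "C_k n k U g"
proof -
  have cont: "continuous_map (subtopology (Euclidean_space n) U) euclideanreal g"
    using C_k_continuous[OF f] by (rule continuous_map_eq) (auto simp: fg)
  obtain T where T: "open T" "U = T \<inter> {x. \<forall>i\<ge>n. x i = 0}"
    by (rule openin_Euclidean_spaceE[OF U])
  show ?thesis
  proof (cases k)
    case 0
    then show ?thesis using cont by simp
  next
    case (Suc l)
    show ?thesis
      unfolding Suc C_k.simps(2)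
    proof (intro conjI allI impI cont)
      fix i assume i: "i < n"
      then obtain f' where
        f': "\<forall>x\<in>U. ((\<lambda>t. f (x(i := t))) has_real_derivative f' x) (at (x i))" "C_k n l U f'"
        using f unfolding Suc C_k.simps(2) by blast
      have "((\<lambda>t. g (x(i := t))) has_real_derivative f' x) (at (x i))" if x: "x \<in> U" for x
      proof (rule has_field_derivative_transform_within_open)
        show "((\<lambda>t. f (x(i := t))) has_real_derivative f' x) (at (x i))"
          using f'(1) x by blast
        have "continuous_on UNIV (\<lambda>t. x(i := t))"
        proof (rule continuous_on_coordinatewise_then_product)
          show "continuous_on UNIV (\<lambda>t. (x(i := t)) j)" for j
            by (cases "j = i") (auto intro: continuous_intros)
        qed
        then show "open ((\<lambda>t. x(i := t)) -` T)"
          using T(1) by (metis continuous_on_open_vimage open_UNIV Int_UNIV_right)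
        show "x i \<in> (\<lambda>t. x(i := t)) -` T"
          using x T by simp
        fix t assume "t \<in> (\<lambda>t. x(i := t)) -` T"
        then show "f (x(i := t)) = g (x(i := t))"
          using x T i by (intro fg) auto
      qed
      then show "\<exists>h. (\<forall>x\<in>U. ((\<lambda>t. g (x(i := t))) has_real_derivative h x) (at (x i))) \<and> C_k n l U h"
        using f' by blast
    qed
  qed
qed

section \<open>Entire power series of arbitrarily fast growth\<close>

text \<open>
  The series is \<open>\<Sum>\<^sub>n (2 x / n)\<^bsup>K n\<^esup>\<close> with strictly increasing exponents. It converges for every \<open>x\<close>, as
  almost all bases \<open>2 x / n\<close> have modulus at most \<open>1/2\<close>; for \<open>x \<ge> n\<close> the \<open>n\<close>-th term alone is at least
  \<open>2\<^bsup>K n\<^esup>\<close>, and \<open>K n\<close> is chosen so large that this is at least \<open>a n\<close>. The term for \<open>n = 0\<close> is a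
  constant, since \<open>2 / 0 = 0\<close>.
\<close>

lemma power_series_dominating:
  fixes a :: "nat \<Rightarrow> real"
  obtains c :: "nat \<Rightarrow> real" where "\<And>x. summable (\<lambda>j. c j * x ^ j)"
    and "\<And>n x. 1 \<le> n \<Longrightarrow> real n \<le> x \<Longrightarrow> a n \<le> (\<Sum>j. c j * x ^ j)"
proof -
  define b where "b n = nat \<lceil>a n\<rceil>" for n
  define K where "K n = n + (\<Sum>m\<le>n. b m)" for n
  have K: "strict_mono K"
    unfolding strict_mono_Suc_iff K_def by simp
  have Kn: "n \<le> K n" for n
    by (simp add: K_def)
  have "b n \<le> K n" for n
    unfolding K_def using member_le_sum[of n "{..n}" b] by simp
  then have aK: "a n \<le> 2 ^ K n" for n
  proof -
    have "a n \<le> real (b n)" unfolding b_def by linarith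
    also have "\<dots> \<le> real (K n)" using \<open>b n \<le> K n\<close> by simp
    also have "\<dots> \<le> 2 ^ K n" using less_exp[of "K n"] by (metis less_imp_le of_nat_le_iff of_nat_numeral of_nat_power)
    finally show ?thesis .
  qed
  define c :: "nat \<Rightarrow> real" where "c j = (if j \<in> range K then (2 / real (inv K j)) ^ j else 0)" for j
  have injK: "inj K" using K by (simp add: strict_mono_imp_inj_on)
  have cK: "c (K n) = (2 / real n) ^ K n" for n
    by (simp add: c_def injK)
  have c0: "0 \<le> c j" for j by (simp add: c_def)
  have summ: "summable (\<lambda>j. c j * x ^ j)" for x
  proof -
    have "summable (\<lambda>n. c (K n) * x ^ K n)"
    proof (rule summable_comparison_test)
      show "summable (\<lambda>n. (1/2 :: real) ^ n)" by (simp add: summable_geometric)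
      obtain M where M: "4 * \<bar>x\<bar> < real M" using reals_Archimedean2 by blast
      have "norm (c (K n) * x ^ K n) \<le> (1/2) ^ n" if n: "n \<ge> M" for n
      proof -
        have npos: "0 < real n" using M n by linarith
        have "norm (c (K n) * x ^ K n) = (\<bar>2 * x / real n\<bar>) ^ K n"
          by (simp add: cK abs_mult power_abs power_mult_distrib power_divide)
        also have "\<dots> \<le> (1/2) ^ K n"
          using M n npos by (intro power_mono) (auto simp: field_simps)
        also have "\<dots> \<le> (1/2) ^ n"
          using Kn by (intro power_decreasing) auto
        finally show ?thesis .
      qed
      then show "\<exists>M. \<forall>n\<ge>M. norm (c (K n) * x ^ K n) \<le> (1/2) ^ n" by blast
    qed
    then show ?thesis
      by (subst (asm) summable_mono_reindex[OF K, of "\<lambda>j. c j * x ^ j"]) (auto simp: c_def)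
  qed
  have "a n \<le> (\<Sum>j. c j * x ^ j)" if n: "1 \<le> n" "real n \<le> x" for n x
  proof -
    have x0: "0 \<le> x" using n by linarith
    have "2 \<le> 2 * x / real n" using n by (simp add: field_simps)
    then have "2 ^ K n \<le> (2 * x / real n) ^ K n"
      by (intro power_mono) auto
    also have "\<dots> = c (K n) * x ^ K n"
      by (simp add: cK power_mult_distrib power_divide)
    also have "\<dots> \<le> (\<Sum>j. c j * x ^ j)"
      using sum_le_suminf[OF summ, of "{K n}" x] x0 c0 by simp
    finally show ?thesis using aK[of n] by linarith
  qed
  with summ show ?thesis by (rule that)
qed

lemma C_k_power_series:
  fixes c :: "nat \<Rightarrow> real"
  assumes "\<And>x. summable (\<lambda>j. c j * x ^ j)" and "C_k n k U f"
  shows "C_k n k U (\<lambda>x. \<Sum>j. c j * f x ^ j)"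
proof -
  have summ: "summable (\<lambda>j. (diffs ^^ i) c j * x ^ j)" for i x
  proof (induction i arbitrary: x)
    case (Suc i)
    then show ?case by (simp add: termdiff_converges_all)
  qed (simp add: assms)
  have "((\<lambda>x. \<Sum>j. (diffs ^^ i) c j * x ^ j) has_real_derivative
      (\<Sum>j. (diffs ^^ Suc i) c j * y ^ j)) (at y)" for i y
    using termdiffs_strong_converges_everywhere[OF summ] by simp
  from C_k_compose[of "\<lambda>i x. \<Sum>j. (diffs ^^ i) c j * x ^ j", OF this assms(2), of 0]
  show ?thesis by simp
qed

section \<open>Deforming the affine simplex into a neighbourhood of a horn\<close>

lemma points_affine_simplex:
  "points (affine_simplex n) = {x \<in> topspace (Euclidean_space (Suc n)). (\<Sum>i\<le>n. x i) = 1}"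
  by (simp add: affine_simplex_def sub_diffeology_def)

lemma plots_affine_simplex:
  "p \<in> plots (affine_simplex m) n U \<longleftrightarrow>
     openin (Euclidean_space n) U \<and> p \<in> U \<rightarrow>\<^sub>E points (affine_simplex m) \<and>
     (\<forall>j\<le>m. \<forall>k. C_k n k U (\<lambda>x. p x j))"
  by (auto simp: affine_simplex_def sub_diffeology_def euclidean_diffeology_def smooth_euclidean_def
      PiE_iff Pi_iff less_Suc_eq_le)

text \<open>
  The points of \<open>\<bbbA>\<^sup>N\<close> are determined by their coordinates \<open>x\<^sub>i\<close> with \<open>i \<le> N\<close> and \<open>i \<noteq> k\<close>, which are linear
  coordinates centred at the vertex \<open>e\<^sub>k\<close>. The product of these coordinates vanishes precisely on the
  faces that make up the horn.
\<close>

definition coord_prod :: "nat \<Rightarrow> nat \<Rightarrow> (nat \<Rightarrow> real) \<Rightarrow> real" where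
  "coord_prod N k x = (\<Prod>i\<in>{..N} - {k}. x i)"

text \<open>The squared Euclidean distance from \<open>e\<^sub>k\<close> in the same coordinates.\<close>

definition coord_sqnorm :: "nat \<Rightarrow> nat \<Rightarrow> (nat \<Rightarrow> real) \<Rightarrow> real" where
  "coord_sqnorm N k x = (\<Sum>i\<in>{..N} - {k}. (x i)\<^sup>2)"

text \<open>The homothety \<open>x \<mapsto> e\<^sub>k + t (x - e\<^sub>k)\<close>; it multiplies the coordinates other than the \<open>k\<close>-th by \<open>t\<close>.\<close>

definition vertex_scale :: "nat \<Rightarrow> real \<Rightarrow> (nat \<Rightarrow> real) \<Rightarrow> (nat \<Rightarrow> real)" where
  "vertex_scale k t x = (\<lambda>i. t * x i + (if i = k then 1 - t else 0))"

lemma vertex_scale_in_affine_simplex: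
  assumes "k \<le> N" "x \<in> points (affine_simplex N)"
  shows "vertex_scale k t x \<in> points (affine_simplex N)"
  using assms
  by (auto simp: points_affine_simplex topspace_Euclidean_space vertex_scale_def sum.distrib
      simp flip: sum_distrib_left)

lemma coord_prod_vertex_scale:
  assumes "k \<le> N"
  shows "coord_prod N k (vertex_scale k t x) = t ^ N * coord_prod N k x"
  using assms by (simp add: coord_prod_def vertex_scale_def prod.distrib)

lemma coord_sqnorm_vertex_scale:
  "coord_sqnorm N k (vertex_scale k t x) = t\<^sup>2 * coord_sqnorm N k x"
  by (simp add: coord_sqnorm_def vertex_scale_def power_mult_distrib sum_distrib_left)

text \<open>
  Within a ball around \<open>e\<^sub>k\<close>, an open set containing the horn contains all points with small coordinate
  product: the part of the ball outside the open set is compact, and the product has no zero there.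
\<close>

lemma horn_neighbourhood:
  assumes k: "k \<le> N" and V: "openin (Euclidean_space (Suc N)) V"
    and H: "\<And>x i. x \<in> points (affine_simplex N) \<Longrightarrow> i \<le> N \<Longrightarrow> i \<noteq> k \<Longrightarrow> x i = 0 \<Longrightarrow> x \<in> V"
  shows "\<exists>\<epsilon>>0. \<forall>x\<in>points (affine_simplex N).
           coord_sqnorm N k x \<le> R \<longrightarrow> \<bar>coord_prod N k x\<bar> \<le> \<epsilon> \<longrightarrow> x \<in> V"
proof -
  obtain T where T: "open T" "V = T \<inter> {x. \<forall>i\<ge>Suc N. x i = 0}"
    by (rule openin_Euclidean_spaceE[OF V])
  have coord: "continuous_on S (\<lambda>x :: nat \<Rightarrow> real. x i)" for S i
    by (rule continuous_on_subset[OF continuous_on_product_coordinates]) simp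
  \<comment> \<open>A box containing all points of \<open>\<bbbA>\<^sup>N\<close> with \<open>coord_sqnorm N k x \<le> R\<close>: the coordinates other than the
    \<open>k\<close>-th have modulus at most \<open>1 + \<bar>R\<bar>\<close>, and \<open>x k\<close> is \<open>1\<close> minus their sum.\<close>
  define c where "c = 1 + real (Suc N) * (1 + \<bar>R\<bar>)"
  define B :: "(nat \<Rightarrow> real) set" where "B = (\<Pi>\<^sub>E i\<in>UNIV. if i \<le> N then {-c..c} else {0})"
  have "compact B"
  proof -
    have "compactin (powertop_real UNIV) B"
      unfolding B_def compactin_PiE by auto
    then show ?thesis
      by (simp only: euclidean_product_topology compactin_euclidean_iff)
  qed
  moreover have "closed {x. (\<Sum>i\<le>N. x i) = (1::real)}"
    by (intro closed_Collect_eq continuous_on_sum coord continuous_on_const)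
  ultimately have comp: "compact (B \<inter> {x. (\<Sum>i\<le>N. x i) = 1} \<inter> - T)" (is "compact ?K")
    using T(1) by (intro compact_Int_closed) auto
  have cont: "continuous_on ?K (\<lambda>x. \<bar>coord_prod N k x\<bar>)"
    unfolding coord_prod_def by (intro continuous_on_rabs continuous_on_prod coord)
  have pos: "0 < \<bar>coord_prod N k x\<bar>" if "x \<in> ?K" for x
  proof -
    have xB: "x \<in> B" and xsum: "(\<Sum>i\<le>N. x i) = 1" and "x \<notin> T"
      using that by simp_all
    have "x i = 0" if "i \<ge> Suc N" for i
      using PiE_mem[OF xB[unfolded B_def], of i] that by simp
    with xsum have "x \<in> points (affine_simplex N)"
      by (simp add: points_affine_simplex topspace_Euclidean_space)
    moreover have "x \<notin> V"
      using \<open>x \<notin> T\<close> by (simp add: T(2))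
    ultimately have "\<forall>i\<in>{..N} - {k}. x i \<noteq> 0" using H by blast
    then show ?thesis by (simp add: coord_prod_def)
  qed
  have "\<exists>\<epsilon>>0. \<forall>x\<in>?K. \<epsilon> < \<bar>coord_prod N k x\<bar>"
  proof (cases "?K = {}")
    case True
    then show ?thesis by (intro exI[of _ 1]) auto
  next
    case False
    from continuous_attains_inf[OF comp this cont] obtain y where
      "y \<in> ?K" and y: "\<And>x. x \<in> ?K \<Longrightarrow> \<bar>coord_prod N k y\<bar> \<le> \<bar>coord_prod N k x\<bar>" by blast
    then have "0 < \<bar>coord_prod N k y\<bar>" using pos by blast
    then show ?thesis
      using y by (intro exI[of _ "\<bar>coord_prod N k y\<bar> / 2"]) fastforce
  qed
  then obtain \<epsilon> where \<epsilon>: "0 < \<epsilon>" "\<And>x. x \<in> ?K \<Longrightarrow> \<epsilon> < \<bar>coord_prod N k x\<bar>" by blast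
  have "x \<in> V" if x: "x \<in> points (affine_simplex N)" and R: "coord_sqnorm N k x \<le> R"
    and P: "\<bar>coord_prod N k x\<bar> \<le> \<epsilon>" for x
  proof (rule ccontr)
    assume "x \<notin> V"
    have le: "\<bar>x i\<bar> \<le> 1 + \<bar>R\<bar>" if "i \<in> {..N} - {k}" for i
    proof -
      have "(x i)\<^sup>2 \<le> coord_sqnorm N k x"
        unfolding coord_sqnorm_def using that by (intro member_le_sum) auto
      also have "\<dots> \<le> (1 + \<bar>R\<bar>)\<^sup>2"
        using R by (auto simp: power2_eq_square algebra_simps intro: order_trans[of _ "\<bar>R\<bar>"])
      finally show ?thesis by (simp add: abs_le_square_iff[symmetric])
    qed
    have "\<bar>\<Sum>i\<in>{..N} - {k}. x i\<bar> \<le> (\<Sum>i\<in>{..N} - {k}. 1 + \<bar>R\<bar>)"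
      using le by (intro order_trans[OF sum_abs] sum_mono) auto
    also have "\<dots> = real N * (1 + \<bar>R\<bar>)" using k by simp
    finally have S: "\<bar>\<Sum>i\<in>{..N} - {k}. x i\<bar> \<le> real N * (1 + \<bar>R\<bar>)" .
    have "x k + (\<Sum>i\<in>{..N} - {k}. x i) = 1"
      using x k by (simp add: points_affine_simplex sum.remove[of "{..N}" k])
    then have "\<bar>x k\<bar> \<le> 1 + real N * (1 + \<bar>R\<bar>)" using S by linarith
    then have "\<bar>x k\<bar> \<le> c" by (simp add: c_def algebra_simps)
    moreover have "\<bar>x i\<bar> \<le> c" if "i \<in> {..N} - {k}" for i
    proof -
      have "0 \<le> real N * \<bar>R\<bar>" by simp
      then show ?thesis using le[OF that] unfolding c_def of_nat_Suc ring_distribs by linarith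
    qed
    ultimately have "\<bar>x i\<bar> \<le> c" if "i \<le> N" for i
      using that by (cases "i = k") auto
    then have "x i \<in> (if i \<le> N then {-c..c} else {0})" for i
      using x by (auto simp: points_affine_simplex topspace_Euclidean_space abs_le_iff minus_le_iff)
    then have "x \<in> B" unfolding B_def PiE_UNIV_domain by blast
    moreover have "x \<notin> T"
      using x \<open>x \<notin> V\<close> by (simp add: T(2) points_affine_simplex topspace_Euclidean_space)
    ultimately have "x \<in> ?K"
      using x by (simp add: points_affine_simplex)
    from \<epsilon>(2)[OF this] P show False by linarith
  qed
  with \<epsilon>(1) show ?thesis by blast
qed

lemma smooth_deformation_into_horn_neighbourhood:
  assumes N: "1 \<le> N" and k: "k \<le> N" and V: "openin (Euclidean_space (Suc N)) V"
    and H: "\<And>x i. x \<in> points (affine_simplex N) \<Longrightarrow> i \<le> N \<Longrightarrow> i \<noteq> k \<Longrightarrow> x i = 0 \<Longrightarrow> x \<in> V"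
  obtains \<rho> where "\<rho> \<in> smooth_maps (affine_simplex N) (affine_simplex N)"
    and "\<And>x. x \<in> points (affine_simplex N) \<Longrightarrow> \<rho> x \<in> V"
    and "\<And>x i. x \<in> points (affine_simplex N) \<Longrightarrow> i \<le> N \<Longrightarrow> i \<noteq> k \<Longrightarrow> x i = 0 \<Longrightarrow> \<rho> x = x"
proof -
  let ?A = "points (affine_simplex N)"
  obtain \<epsilon> where \<epsilon>: "\<And>n. 0 < \<epsilon> n" "\<And>n x. x \<in> ?A \<Longrightarrow> coord_sqnorm N k x \<le> real n \<Longrightarrow>
      \<bar>coord_prod N k x\<bar> \<le> \<epsilon> n \<Longrightarrow> x \<in> V"
  proof -
    have "\<forall>n. \<exists>\<epsilon>>0. \<forall>x\<in>?A. coord_sqnorm N k x \<le> real n \<longrightarrow> \<bar>coord_prod N k x\<bar> \<le> \<epsilon> \<longrightarrow> x \<in> V"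
      using horn_neighbourhood[OF k V] H by blast
    then show ?thesis
      unfolding choice_iff using that by blast
  qed
  obtain c where c: "\<And>x. summable (\<lambda>j. c j * x ^ j)"
    and big: "\<And>n x. 1 \<le> n \<Longrightarrow> real n \<le> x \<Longrightarrow> 1 / (\<epsilon> n)\<^sup>2 \<le> (\<Sum>j. c j * x ^ j)"
    using power_series_dominating[of "\<lambda>n. 1 / (\<epsilon> n)\<^sup>2"] by blast
  define G where "G x = (\<Sum>j. c j * x ^ j)" for x
  define t where "t x = exp ((-1) * ((coord_prod N k x)\<^sup>2 * G (1 + coord_sqnorm N k x)))" for x
  define \<rho> where "\<rho> = (\<lambda>x\<in>?A. vertex_scale k (t x) x)"
  have \<rho>A: "\<rho> x \<in> ?A" if "x \<in> ?A" for x
    using vertex_scale_in_affine_simplex[OF k that] that by (simp add: \<rho>_def)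
  show ?thesis
  proof
    show "\<rho> x \<in> V" if x: "x \<in> ?A" for x
    proof -
      let ?P = "coord_prod N k x" and ?Q = "coord_sqnorm N k x"
      define n where "n = nat \<lfloor>1 + ?Q\<rfloor>"
      have Q: "0 \<le> ?Q" by (simp add: coord_sqnorm_def sum_nonneg)
      then have n: "1 \<le> n" "real n \<le> 1 + ?Q" "?Q \<le> real n"
        unfolding n_def by linarith+
      have G: "1 / (\<epsilon> n)\<^sup>2 \<le> G (1 + ?Q)"
        unfolding G_def by (rule big[OF n(1,2)])
      have e: "0 < \<epsilon> n" by (rule \<epsilon>)
      have "0 \<le> 1 / (\<epsilon> n)\<^sup>2" by simp
      then have G0: "0 \<le> G (1 + ?Q)" using G by linarith
      have t: "0 \<le> t x" "t x \<le> 1" using G0 by (auto simp: t_def)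
      \<comment> \<open>Next, \<open>t x * \<bar>?P\<bar> \<le> \<epsilon> n\<close>, from \<open>u \<le> 1 + u\<^sup>2\<close> for \<open>u = \<bar>?P\<bar> / \<epsilon> n\<close> and \<open>1 + y \<le> exp y\<close>.\<close>
      have "\<bar>?P\<bar> \<le> \<epsilon> n * (1 + ?P\<^sup>2 * (1 / (\<epsilon> n)\<^sup>2))"
      proof (cases "\<bar>?P\<bar> \<le> \<epsilon> n")
        case True
        then show ?thesis using e by (simp add: algebra_simps power2_eq_square add_increasing2)
      next
        case False
        then have "\<bar>?P\<bar> * \<epsilon> n \<le> \<bar>?P\<bar> * \<bar>?P\<bar>" by (intro mult_left_mono) auto
        then have "\<bar>?P\<bar> \<le> ?P\<^sup>2 / \<epsilon> n" using e by (simp add: field_simps power2_eq_square)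
        then show ?thesis using e by (simp add: algebra_simps power2_eq_square)
      qed
      also have "\<dots> \<le> \<epsilon> n * (1 + ?P\<^sup>2 * G (1 + ?Q))"
        using e G by (intro mult_left_mono add_left_mono) auto
      also have "\<dots> \<le> \<epsilon> n * exp (?P\<^sup>2 * G (1 + ?Q))"
        using e by (intro mult_left_mono exp_ge_add_one_self) auto
      also have "\<dots> = \<epsilon> n / t x" by (simp add: t_def exp_minus field_simps)
      finally have Pt: "t x * \<bar>?P\<bar> \<le> \<epsilon> n" by (simp add: t_def field_simps)
      \<comment> \<open>Here \<open>1 \<le> N\<close> is essential: for \<open>N = 0\<close> the product is empty and scaling does not change it.\<close>
      have "t x ^ N \<le> t x" using power_decreasing[OF N t] by simp
      then have "t x ^ N * \<bar>?P\<bar> \<le> t x * \<bar>?P\<bar>" by (rule mult_right_mono) simp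
      then have "\<bar>coord_prod N k (\<rho> x)\<bar> \<le> \<epsilon> n"
        using Pt t x by (simp add: \<rho>_def coord_prod_vertex_scale[OF k] abs_mult)
      moreover have "coord_sqnorm N k (\<rho> x) \<le> real n"
      proof -
        have "(t x)\<^sup>2 * ?Q \<le> 1 * ?Q" using t Q by (intro mult_right_mono) (auto simp: power_le_one)
        then show ?thesis using n x by (simp add: \<rho>_def coord_sqnorm_vertex_scale)
      qed
      ultimately show ?thesis using \<epsilon>(2) \<rho>A[OF x] by blast
    qed
    show "\<rho> x = x" if "x \<in> ?A" "i \<le> N" "i \<noteq> k" "x i = 0" for x i
    proof -
      have "coord_prod N k x = 0" using that by (auto simp: coord_prod_def)
      then show ?thesis using that by (simp add: \<rho>_def t_def vertex_scale_def fun_eq_iff)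
    qed
    show "\<rho> \<in> smooth_maps (affine_simplex N) (affine_simplex N)"
      unfolding smooth_maps_def
    proof (intro CollectI conjI allI ballI)
      show "\<rho> \<in> ?A \<rightarrow>\<^sub>E ?A" using \<rho>A by (auto simp: \<rho>_def)
      fix n U p assume p: "p \<in> plots (affine_simplex N) n U"
      then have U: "openin (Euclidean_space n) U" and pA: "p \<in> U \<rightarrow>\<^sub>E ?A"
        and C: "\<And>j m. j \<le> N \<Longrightarrow> C_k n m U (\<lambda>x. p x j)"
        by (auto simp: plots_affine_simplex)
      have P: "C_k n m U (\<lambda>x. coord_prod N k (p x))" for m
        unfolding coord_prod_def by (intro C_k_prod C) auto
      have Q: "C_k n m U (\<lambda>x. coord_sqnorm N k (p x))" for m
        unfolding coord_sqnorm_def power2_eq_square by (intro C_k_sum C_k_mult C) auto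
      have G: "C_k n m U (\<lambda>x. G (1 + coord_sqnorm N k (p x)))" for m
        unfolding G_def by (intro C_k_power_series c C_k_add C_k_const Q)
      have t: "C_k n m U (\<lambda>x. t (p x))" for m
        unfolding t_def power2_eq_square
        by (rule C_k_compose[of "\<lambda>_. exp"]) (intro DERIV_exp C_k_mult C_k_const P G)+
      have 1: "C_k n m U (\<lambda>x. t (p x) * p x j + (if j = k then 1 + (-1) * t (p x) else 0))"
        if "j \<le> N" for j m
        using that by (intro C_k_if C_k_add C_k_mult C_k_const t C)
      have "C_k n m U (\<lambda>x. compose U \<rho> p x j)" if "j \<le> N" for j m
        using pA by (intro C_k_cong[OF U _ 1[OF that]]) (auto simp: compose_def \<rho>_def vertex_scale_def)
      then show "compose U \<rho> p \<in> plots (affine_simplex N) n U"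
        using U pA \<rho>A by (auto simp: plots_affine_simplex compose_def)
    qed
  qed
qed

section \<open>Induced maps between affine simplices\<close>

lemma affine_push_in_affine_simplex:
  assumes f: "f \<in> simplex_maps n m" and x: "x \<in> points (affine_simplex n)"
  shows "affine_push n f x \<in> points (affine_simplex m)"
proof -
  have fm: "f i \<le> m" if "i \<le> n" for i
    using f that by (auto simp: simplex_maps_def)
  have "(\<Sum>j\<le>m. \<Sum>i | i \<le> n \<and> f i = j. x i) = (\<Sum>i\<le>n. x i)"
    using sum.group[of "{..n}" "{..m}" f x] fm by (auto simp: image_subset_iff)
  moreover have "affine_push n f x j = 0" if "j \<ge> Suc m" for j
  proof -
    have "{i. i \<le> n \<and> f i = j} = {}" using that fm by fastforce
    then show ?thesis unfolding affine_push_def by (simp only: sum.empty)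
  qed
  ultimately show ?thesis
    using x by (simp add: points_affine_simplex topspace_Euclidean_space affine_push_def)
qed

lemma affine_push_missed_coordinate:
  assumes "i \<notin> s ` {..n}"
  shows "affine_push n s x i = 0"
proof -
  have "{j. j \<le> n \<and> s j = i} = {}" using assms by auto
  then show ?thesis unfolding affine_push_def by (simp only: sum.empty)
qed

text \<open>
  The hyperplane \<open>x\<^sub>i = 0\<close> of \<open>\<bbbA>\<^sup>N\<close> is covered by a simplex of the horn. Instead of the face map
  \<open>[N - 1] \<rightarrow> [N]\<close> this uses the degenerate \<open>s : [N] \<rightarrow> [N]\<close> that sends \<open>i\<close> to a neighbour and fixes all
  other vertices, since then \<open>s\<^sub>*\<close> fixes the hyperplane pointwise and no reindexing is needed.
\<close>

lemma affine_hyperplane_point_is_push: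
  assumes N: "1 \<le> N" and i: "i \<le> N" and x: "x \<in> points (affine_simplex N)" and xi: "x i = 0"
  obtains s where "s \<in> simplex_maps N N" "i \<notin> s ` {..N}" "affine_push N s x = x"
proof -
  define i' where "i' = (if i = 0 then 1 else i - 1)"
  define s where "s = (\<lambda>j\<in>{..N}. if j = i then i' else j)"
  have ne: "i' \<noteq> i" "i' \<le> N" using N i by (auto simp: i'_def)
  have "mono_on {..N} s"
    by (auto simp: s_def i'_def mono_on_def)
  then have "s \<in> simplex_maps N N"
    using ne by (auto simp: simplex_maps_def s_def)
  moreover have "i \<notin> s ` {..N}" using ne by (auto simp: s_def)
  moreover have "affine_push N s x = x"
  proof
    fix j
    consider "j > N" | "j = i" | "j = i'" | "j \<le> N" "j \<noteq> i" "j \<noteq> i'" by linarith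
    then show "affine_push N s x j = x j"
    proof cases
      case 1
      then have "j \<notin> s ` {..N}" using ne by (auto simp: s_def)
      then show ?thesis
        using affine_push_missed_coordinate x 1
        by (simp add: points_affine_simplex topspace_Euclidean_space)
    next
      case 2
      then show ?thesis using affine_push_missed_coordinate[of i s N x] xi \<open>i \<notin> s ` {..N}\<close> by simp
    next
      case 3
      then have "{l. l \<le> N \<and> s l = j} = {i, i'}" using ne i by (auto simp: s_def)
      then show ?thesis using ne xi 3 unfolding affine_push_def by simp
    next
      case 4
      then have "{l. l \<le> N \<and> s l = j} = {j}" by (auto simp: s_def)
      then show ?thesis unfolding affine_push_def by simp
    qed
  qed
  ultimately show ?thesis by (rule that)
qed

section \<open>Smooth maps and subspaces\<close>

lemma smooth_maps_sub_diffeology: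
  assumes A: "A \<subseteq> points X" and Y: "\<And>n U p. p \<in> plots Y n U \<Longrightarrow> p \<in> U \<rightarrow> points Y"
  shows "\<sigma> \<in> smooth_maps Y (sub_diffeology X A) \<longleftrightarrow> \<sigma> \<in> smooth_maps Y X \<and> \<sigma> \<in> points Y \<rightarrow> A"
proof
  assume "\<sigma> \<in> smooth_maps Y (sub_diffeology X A)"
  then show "\<sigma> \<in> smooth_maps Y X \<and> \<sigma> \<in> points Y \<rightarrow> A"
    using A by (auto simp: smooth_maps_def sub_diffeology_def PiE_iff)
next
  assume \<sigma>: "\<sigma> \<in> smooth_maps Y X \<and> \<sigma> \<in> points Y \<rightarrow> A"
  then have "compose U \<sigma> p \<in> U \<rightarrow> A" if "p \<in> plots Y n U" for n U p
    using Y[OF that] by (auto simp: compose_def Pi_iff)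
  with \<sigma> show "\<sigma> \<in> smooth_maps Y (sub_diffeology X A)"
    by (auto simp: smooth_maps_def sub_diffeology_def PiE_iff)
qed

lemma smooth_maps_compose:
  assumes \<rho>: "\<rho> \<in> smooth_maps X Y" and \<sigma>: "\<sigma> \<in> smooth_maps Y Z"
    and X: "\<And>n U p. p \<in> plots X n U \<Longrightarrow> p \<in> U \<rightarrow> points X"
  shows "compose (points X) \<sigma> \<rho> \<in> smooth_maps X Z"
proof -
  have "compose U (compose (points X) \<sigma> \<rho>) p \<in> plots Z n U" if p: "p \<in> plots X n U" for n U p
  proof -
    have "compose U (compose (points X) \<sigma> \<rho>) p = compose U \<sigma> (compose U \<rho> p)"
      using X[OF p] by (auto simp: compose_def fun_eq_iff Pi_iff)
    then show ?thesis using \<rho> \<sigma> p by (simp add: smooth_maps_def)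
  qed
  then show ?thesis
    using \<rho> \<sigma> by (auto simp: smooth_maps_def compose_def PiE_iff Pi_iff)
qed

lemma plots_affine_simplex_in_points:
  "p \<in> plots (affine_simplex m) n U \<Longrightarrow> p \<in> U \<rightarrow> points (affine_simplex m)"
  by (auto simp: plots_affine_simplex)

text \<open>
  Preimages of \<open>D\<close>-open sets under smooth maps on \<open>\<bbbA>\<^sup>N\<close> are relatively open. It suffices to test with
  one plot, the affine retraction \<open>x \<mapsto> x + (1 - \<Sum>\<^sub>i x\<^sub>i) e\<^sub>0\<close> of \<open>\<real>\<^bsup>N+1\<^esup>\<close> onto \<open>\<bbbA>\<^sup>N\<close>.
\<close>

lemma preimage_D_open:
  assumes X: "diffeological_space X" and A: "openin (D_topology X) A"
    and \<sigma>: "\<sigma> \<in> smooth_maps (affine_simplex N) X"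
  obtains V where "openin (Euclidean_space (Suc N)) V"
    and "\<And>x. x \<in> points (affine_simplex N) \<Longrightarrow> x \<in> V \<longleftrightarrow> \<sigma> x \<in> A"
proof -
  let ?E = "topspace (Euclidean_space (Suc N))"
  define p :: "(nat \<Rightarrow> real) \<Rightarrow> nat \<Rightarrow> real"
    where "p = (\<lambda>x\<in>?E. \<lambda>j. x j + (if j = 0 then 1 + (-1) * (\<Sum>i\<le>N. x i) else 0))"
  have pid: "p x = x" if "x \<in> points (affine_simplex N)" for x
    using that by (auto simp: p_def points_affine_simplex fun_eq_iff)
  have "p \<in> plots (affine_simplex N) (Suc N) ?E"
    unfolding plots_affine_simplex
  proof (intro conjI allI impI)
    show "p \<in> ?E \<rightarrow>\<^sub>E points (affine_simplex N)"
      by (auto simp: p_def points_affine_simplex topspace_Euclidean_space sum.distrib)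
    fix j m
    have 1: "C_k (Suc N) m ?E (\<lambda>x. x j + (if j = 0 then 1 + (-1) * (\<Sum>i\<le>N. x i) else 0))"
      by (intro C_k_if C_k_add C_k_mult C_k_const C_k_sum C_k_coordinate) auto
    show "C_k (Suc N) m ?E (\<lambda>x. p x j)"
      by (rule C_k_cong[OF _ _ 1]) (auto simp: p_def)
  qed simp
  then have "compose ?E \<sigma> p \<in> plots X (Suc N) ?E"
    using \<sigma> by (simp add: smooth_maps_def)
  then have "openin (subtopology (Euclidean_space (Suc N)) ?E) {u \<in> ?E. compose ?E \<sigma> p u \<in> A}"
    using A unfolding openin_D_topology[OF X] by blast
  then show ?thesis
    by (intro that[of "{u \<in> ?E. compose ?E \<sigma> p u \<in> A}"])
      (auto simp: compose_def pid points_affine_simplex simp del: topspace_Euclidean_space)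
qed

section \<open>Horn fillers in the smooth singular simplicial set\<close>

lemma simplices_smooth_singular_sub:
  assumes "A \<subseteq> points X"
  shows "\<sigma> \<in> simplices (smooth_singular (sub_diffeology X A)) n \<longleftrightarrow>
     \<sigma> \<in> simplices (smooth_singular X) n \<and> \<sigma> \<in> points (affine_simplex n) \<rightarrow> A"
  using smooth_maps_sub_diffeology[OF assms plots_affine_simplex_in_points]
  by (simp add: smooth_singular_def)

lemma action_smooth_singular_sub:
  "action (smooth_singular (sub_diffeology X A)) = action (smooth_singular X)"
  by (simp add: smooth_singular_def)

lemma simplicial_set_smooth_singular_sub:
  assumes A: "A \<subseteq> points X" and X: "simplicial_set (smooth_singular X)"
  shows "simplicial_set (smooth_singular (sub_diffeology X A))"
proof -
  have "action (smooth_singular X) n m f \<sigma> \<in> points (affine_simplex n) \<rightarrow> A"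
    if "f \<in> simplex_maps n m" "\<sigma> \<in> points (affine_simplex m) \<rightarrow> A" for n m f \<sigma>
    using that affine_push_in_affine_simplex[OF that(1)]
    by (auto simp: smooth_singular_def compose_def)
  with X show ?thesis
    unfolding simplicial_set_def
    by (simp add: simplices_smooth_singular_sub[OF A] action_smooth_singular_sub Pi_iff)
qed

text \<open>The half of the Yoneda lemma that turns an \<open>N\<close>-simplex into a map from the standard simplex.\<close>

lemma simplicial_morphism_of_simplex:
  assumes K: "simplicial_set K" and \<tau>: "\<tau> \<in> simplices K N"
  shows "simplicial_morphism (standard_simplex N) K (\<lambda>n s. action K n N s \<tau>)"
  unfolding simplicial_morphism_def
proof (intro conjI allI ballI)
  show "(\<lambda>s. action K n N s \<tau>) \<in> simplices (standard_simplex N) n \<rightarrow> simplices K n" for n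
    using K \<tau> unfolding simplicial_set_def standard_simplex_def by (auto simp: Pi_iff)
  fix n m f s assume "f \<in> simplex_maps n m" and "s \<in> simplices (standard_simplex N) m"
  then show "action K n N (action (standard_simplex N) n m f s) \<tau> =
      action K n m f (action K m N s \<tau>)"
    using K[unfolded simplicial_set_def, THEN conjunct2, THEN conjunct2] \<tau>
    by (simp add: standard_simplex_def)
qed

theorem theorem4p40:
  fixes X :: "'a diffeology" and A :: "'a set"
  assumes "fibrant X"
    and "openin (D_topology X) A"
  shows "fibrant (sub_diffeology X A)"
proof -
  let ?S = "smooth_singular X" and ?T = "smooth_singular (sub_diffeology X A)"
  have X: "diffeological_space X" and simp_S: "simplicial_set ?S"
    and filler: "\<And>N k \<phi>. 1 \<le> N \<Longrightarrow> k \<le> N \<Longrightarrow> simplicial_morphism (horn N k) ?S \<phi> \<Longrightarrow>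
        \<exists>\<psi>. simplicial_morphism (standard_simplex N) ?S \<psi> \<and>
             (\<forall>n. \<forall>s\<in>simplices (horn N k) n. \<psi> n s = \<phi> n s)"
    using assms(1) by (auto simp: fibrant_def Kan_complex_def)
  have A: "A \<subseteq> points X"
    using openin_subset[OF assms(2)] by (simp add: topspace_D_topology[OF X])
  note mem_T = simplices_smooth_singular_sub[OF A] and action_T = action_smooth_singular_sub[of X A]
  have simp_T: "simplicial_set ?T"
    by (rule simplicial_set_smooth_singular_sub[OF A simp_S])
  have "\<exists>\<psi>. simplicial_morphism (standard_simplex N) ?T \<psi> \<and>
             (\<forall>n. \<forall>s\<in>simplices (horn N k) n. \<psi> n s = \<phi> n s)"
    if N: "1 \<le> N" and k: "k \<le> N" and \<phi>: "simplicial_morphism (horn N k) ?T \<phi>" for N k \<phi>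
  proof -
    let ?P = "points (affine_simplex N)"
    have horn: "s \<in> simplices (horn N k) n \<longleftrightarrow>
        s \<in> simplex_maps n N \<and> (\<exists>i\<le>N. i \<noteq> k \<and> i \<notin> s ` {..n})" for s n
      by (simp add: horn_def)
    have \<phi>A: "\<phi> n s \<in> points (affine_simplex n) \<rightarrow> A" if "s \<in> simplices (horn N k) n" for n s
    proof -
      have "\<phi> n s \<in> simplices ?T n"
        using \<phi> that unfolding simplicial_morphism_def by blast
      then show ?thesis by (simp add: mem_T)
    qed
    have "simplicial_morphism (horn N k) ?S \<phi>"
      using \<phi> by (simp add: simplicial_morphism_def mem_T action_T Pi_iff)
    from filler[OF N k this] obtain \<psi> where
      \<psi>: "simplicial_morphism (standard_simplex N) ?S \<psi>"
      and \<psi>\<phi>: "\<And>n s. s \<in> simplices (horn N k) n \<Longrightarrow> \<psi> n s = \<phi> n s" by blast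
    \<comment> \<open>By naturality \<open>\<psi>\<close> is determined by its value \<open>\<sigma>\<close> on the nondegenerate \<open>N\<close>-simplex \<open>\<iota>\<close>.\<close>
    define \<iota> where "\<iota> = (\<lambda>i\<in>{..N}. i)"
    have \<iota>: "\<iota> \<in> simplex_maps N N"
      by (auto simp: \<iota>_def simplex_maps_def mono_on_def)
    define \<sigma> where "\<sigma> = \<psi> N \<iota>"
    have \<sigma>: "\<sigma> \<in> smooth_maps (affine_simplex N) X"
      using \<psi> \<iota> by (auto simp: simplicial_morphism_def standard_simplex_def smooth_singular_def \<sigma>_def)
    have \<psi>\<sigma>: "\<psi> n s = compose (points (affine_simplex n)) \<sigma> (affine_push n s)"
      if s: "s \<in> simplex_maps n N" for n s
    proof -
      have "\<iota> \<in> simplices (standard_simplex N) N"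
        using \<iota> by (simp add: standard_simplex_def)
      then have "\<psi> n (compose {..n} \<iota> s) = compose (points (affine_simplex n)) \<sigma> (affine_push n s)"
        using \<psi> s unfolding simplicial_morphism_def \<sigma>_def
        by (simp add: standard_simplex_def smooth_singular_def)
      moreover have "compose {..n} \<iota> s = s"
        using s by (auto simp: \<iota>_def compose_def simplex_maps_def PiE_iff extensional_def fun_eq_iff)
      ultimately show ?thesis by simp
    qed
    obtain V where V: "openin (Euclidean_space (Suc N)) V"
      and V_iff: "\<And>x. x \<in> ?P \<Longrightarrow> x \<in> V \<longleftrightarrow> \<sigma> x \<in> A"
      using preimage_D_open[OF X assms(2) \<sigma>] by blast
    have H: "x \<in> V" if x: "x \<in> ?P" and i: "i \<le> N" "i \<noteq> k" "x i = 0" for x i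
    proof -
      obtain s where s: "s \<in> simplex_maps N N" "i \<notin> s ` {..N}" "affine_push N s x = x"
        using affine_hyperplane_point_is_push[OF N i(1) x i(3)] by blast
      then have "s \<in> simplices (horn N k) N" using i horn by blast
      then have "\<psi> N s x \<in> A" using \<phi>A \<psi>\<phi> x by (auto simp: Pi_iff)
      then have "\<sigma> x \<in> A" using \<psi>\<sigma>[OF s(1)] s(3) x by (simp add: compose_def)
      then show ?thesis using V_iff x by simp
    qed
    obtain \<rho> where \<rho>: "\<rho> \<in> smooth_maps (affine_simplex N) (affine_simplex N)"
      and \<rho>V: "\<And>x. x \<in> ?P \<Longrightarrow> \<rho> x \<in> V"
      and \<rho>_id: "\<And>x i. x \<in> ?P \<Longrightarrow> i \<le> N \<Longrightarrow> i \<noteq> k \<Longrightarrow> x i = 0 \<Longrightarrow> \<rho> x = x"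
      using smooth_deformation_into_horn_neighbourhood[OF N k V] H by metis
    define \<tau> where "\<tau> = compose ?P \<sigma> \<rho>"
    have "\<tau> \<in> simplices ?S N"
      using smooth_maps_compose[OF \<rho> \<sigma> plots_affine_simplex_in_points]
      by (simp add: \<tau>_def smooth_singular_def)
    moreover have "\<tau> \<in> ?P \<rightarrow> A"
      using \<rho> \<rho>V V_iff by (auto simp: \<tau>_def compose_def smooth_maps_def PiE_iff Pi_iff)
    ultimately have "\<tau> \<in> simplices ?T N"
      by (simp add: mem_T)
    moreover have "action ?T n N s \<tau> = \<phi> n s" if s: "s \<in> simplices (horn N k) n" for n s
    proof -
      obtain i where i: "i \<le> N" "i \<noteq> k" "i \<notin> s ` {..n}" and sN: "s \<in> simplex_maps n N"
        using s horn by blast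
      have "\<tau> (affine_push n s x) = \<sigma> (affine_push n s x)" if x: "x \<in> points (affine_simplex n)" for x
        using affine_push_in_affine_simplex[OF sN x] affine_push_missed_coordinate[OF i(3)] \<rho>_id i
        by (simp add: \<tau>_def compose_def)
      then have "action ?T n N s \<tau> = compose (points (affine_simplex n)) \<sigma> (affine_push n s)"
        by (auto simp: smooth_singular_def compose_def fun_eq_iff)
      then show ?thesis using \<psi>\<sigma>[OF sN] \<psi>\<phi>[OF s] by simp
    qed
    ultimately show ?thesis
      using simplicial_morphism_of_simplex[OF simp_T] by blast
  qed
  then show ?thesis
    using diffeological_space_sub_diffeology[OF X A] simp_T
    by (simp add: fibrant_def Kan_complex_def)
qed

end
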